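(* Let $n\ge1$. For $1\le r\le n$, the number of ordinary summations of type $(r,n-r+1)$ in $W([n])$, i.e. the number of $\alpha\in S_n$ with $dP(FS_\alpha)=r$ and $dD(FS_\alpha)=n-r+1$, is the Narayana number $$\frac{1}{n+1}\binom{n+1}{r}\binom{n-1}{r-1}.$$ The number of all ordinary summations in $W([n])$, i.e. the number of $\alpha\in S_n$ with $d(FS_\alpha)=n+1$, is the Catalan number $$\sum_{r=1}^{n}\frac{1}{n+1}\binom{n+1}{r}\binom{n-1}{r-1}=\frac{1}{n+1}\binom{2n}{n}.$$
   Context: **The quiver $\hat Q_\alpha$.** For $\alpha\in S_n$, $\hat Q_\alpha$ is the directed graph with vertices $1,\dots,n+1$ and arrows $i\to\alpha(i)$ for $2\le i\le n$ together with $n+1\to\alpha(1)$. It consists of one chain, from $n+1$ to $1$, and possibly some loops (directed cycles, a vertex with a self-arrow being allowed). Each $t\in\{1,\dots,n\}$ is the target of exactly one arrow. One recovers $\alpha$ from $\hat Q_\alpha$ by replacing $n+1$ by $1$. **The permutations $[\alpha,j]\in S_{n+1}$.** For $\alpha\in S_n$ and $0\le j\le n$, $[\alpha,j]$ is the permutation $\beta\in S_{n+1}$ whose quiver $\hat Q_\beta$ (on vertices $1,\dots,n+2$) is obtained from $\hat Q_\alpha$ as follows. If $j=0$: add the vertex $n+2$ and the arrow $n+2\to n+1$. If $j\ge1$: let $i\to j$ be the unique arrow of $\hat Q_\alpha$ with target $j$; delete it, add the vertex $n+2$, and add the arrows $n+2\to j$ and $i\to n+1$. Every element of $S_{n+1}$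 is $[\alpha,j]$ for exactly one pair $(\alpha,j)$. **The summations $FS_\alpha$.** Define recursively a set partition $\pi_\alpha$ of $\{1,\dots,n\}$ for $\alpha\in S_n$: for the unique element $(1)\in S_1$, $\pi_{(1)}=\{\{1\}\}$; $\pi_{[\alpha,0]}=\pi_\alpha\cup\{\{n+1\}\}$; for $1\le j\le n$, $\pi_{[\alpha,j]}$ is obtained from $\pi_\alpha$ by adding $n+1$ to the block containing $j$. For $k_1,\dots,k_n\ge1$ and $B\subseteq\{1,\dots,n\}$ put $k_B=\sum_{t\in B}k_t$. The summation $FS_\alpha$ is the differential operator on $\mathbb{C}[p_1,p_2,\dots]$ $$FS_\alpha=\frac1n\sum_{k_1,\dots,k_n\ge1}\ \Big(\prod_{c}p_{k_c}\Big)\prod_{B\in\pi_\alpha}k_B\frac{\partial}{\partial p_{k_B}},$$ where $c$ runs over the (supports of the) disjoint cycles of $\alpha$, fixed points included. The $W$-operator is $W([n])=\sum_{\alpha\in S_n}FS_\alpha$, and "the summations in $W([n])$" are the $FS_\alpha$, counted by $\alpha\in S_n$. **Degree.** $dP(FS_\alpha)$ is the degree of the polynomial part (the number of factors $p_{k_c}$), $dD(FS_\alpha)$ is the order of the differential part (the number of factors $\partial/\partial p_{k_B}$), and $d(FS_\alpha)=dP(FS_\alpha)+dD(FS_\alpha)$. For $\alpha\in S_n$, $FS_\alpha$ is an ordinary summation (OS) if $d(FS_\alpha)=n+1$; it is of type $(r,n-r+1)$ if $dP(FS_\alpha)=r$ and $dD(FS_\alpha)=n-r+1$. *)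

theory Defs
  imports Complex_Main "HOL-Combinatorics.Orbits" "HOL-Library.Poly_Mapping"
begin

text \<open>
  A permutation in \<open>S_n\<close> is a function \<open>\<alpha> :: nat \<Rightarrow> nat\<close> with \<open>\<alpha> permutes {1..n}\<close>.  Since \<open>\<alpha>\<close> does not
  determine \<open>n\<close>, the constructions below take \<open>n\<close> as an explicit argument.
\<close>

definition quiver :: "nat \<Rightarrow> (nat \<Rightarrow> nat) \<Rightarrow> (nat \<times> nat) set" where
  "quiver n \<alpha> = insert (n + 1, \<alpha> 1) {(i, \<alpha> i) | i. 2 \<le> i \<and> i \<le> n}"

text \<open>The modification of a quiver on \<open>{1..n + 1}\<close> that yields a quiver on \<open>{1..n + 2}\<close>.\<close>

definition extend_quiver :: "nat \<Rightarrow> (nat \<times> nat) set \<Rightarrow> nat \<Rightarrow> (nat \<times> nat) set" where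
  "extend_quiver n Q j =
    (if j = 0 then insert (n + 2, n + 1) Q
     else let i = (THE i. (i, j) \<in> Q) in (Q - {(i, j)}) \<union> {(n + 2, j), (i, n + 1)})"

text \<open>\<open>extend n \<alpha> j\<close> is \<open>[\<alpha>, j] \<in> S_(n + 1)\<close>, for \<open>n \<ge> 1\<close>, \<open>\<alpha> \<in> S_n\<close> and \<open>0 \<le> j \<le> n\<close>.\<close>

definition extend :: "nat \<Rightarrow> (nat \<Rightarrow> nat) \<Rightarrow> nat \<Rightarrow> (nat \<Rightarrow> nat)" where
  "extend n \<alpha> j =
    (THE \<beta>. \<beta> permutes {1..n + 1} \<and> quiver (n + 1) \<beta> = extend_quiver n (quiver n \<alpha>) j)"

text \<open>The unique pair \<open>(\<alpha>, j)\<close> with \<open>\<beta> = [\<alpha>, j]\<close>, for \<open>\<beta> \<in> S_(n + 1)\<close>.\<close>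

definition unextend :: "nat \<Rightarrow> (nat \<Rightarrow> nat) \<Rightarrow> (nat \<Rightarrow> nat) \<times> nat" where
  "unextend n \<beta> = (THE (\<alpha>, j). \<alpha> permutes {1..n} \<and> j \<le> n \<and> extend n \<alpha> j = \<beta>)"

text \<open>\<open>perm_partition n \<alpha>\<close> is \<open>\<pi>_\<alpha>\<close>; the value at \<open>n = 0\<close> is irrelevant.\<close>

fun perm_partition :: "nat \<Rightarrow> (nat \<Rightarrow> nat) \<Rightarrow> nat set set" where
  "perm_partition 0 \<beta> = {}"
| "perm_partition (Suc 0) \<beta> = {{1}}"
| "perm_partition (Suc (Suc m)) \<beta> =
    (let n = Suc m; (\<alpha>, j) = unextend n \<beta>; P = perm_partition n \<alpha> in
     if j = 0 then P \<union> {{n + 1}}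
     else (\<lambda>B. if j \<in> B then insert (n + 1) B else B) ` P)"

definition cycle_supports :: "nat \<Rightarrow> (nat \<Rightarrow> nat) \<Rightarrow> nat set set" where
  "cycle_supports n \<alpha> = orbit \<alpha> ` {1..n}"

text \<open>
  The expression \<open>1/n \<Sum>\<^bsub>k_1,...,k_n \<ge> 1\<^esub> (\<Prod>\<^bsub>c \<in> C\<^esub> p_(k_c)) (\<Prod>\<^bsub>B \<in> D\<^esub> k_B \<partial>/\<partial>p_(k_B))\<close>, where \<open>k_B\<close> denotes
  \<open>\<Sum>\<^bsub>t \<in> B\<^esub> k_t\<close>, is represented by \<open>Summation n C D\<close>.  Its degrees count the factors in the
  expression; the operator it denotes is \<open>summation_operator\<close> below.
\<close>

datatype summation =
  Summation (arity: nat) (poly_factors: "nat set set") (diff_factors: "nat set set")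

definition FS :: "nat \<Rightarrow> (nat \<Rightarrow> nat) \<Rightarrow> summation" where
  "FS n \<alpha> = Summation n (cycle_supports n \<alpha>) (perm_partition n \<alpha>)"

definition dP :: "summation \<Rightarrow> nat" where
  "dP S = card (poly_factors S)"

definition dD :: "summation \<Rightarrow> nat" where
  "dD S = card (diff_factors S)"

definition deg :: "summation \<Rightarrow> nat" where
  "deg S = dP S + dD S"

text \<open>
  Polynomials in \<open>p_0, p_1, p_2, \<dots>\<close>, as finitely supported functions from exponent vectors to
  coefficients.  The operators below involve only the variables \<open>p_k\<close> with \<open>k \<ge> 1\<close>, so they restrict
  to the polynomials in \<open>p_1, p_2, \<dots>\<close>.
\<close>

type_synonym cpoly = "(nat \<Rightarrow>\<^sub>0 nat) \<Rightarrow>\<^sub>0 complex"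

definition pvar :: "nat \<Rightarrow> cpoly" where
  "pvar i = Poly_Mapping.single (Poly_Mapping.single i 1) 1"

definition pconst :: "complex \<Rightarrow> cpoly" where
  "pconst c = Poly_Mapping.single 0 c"

definition pd :: "nat \<Rightarrow> cpoly \<Rightarrow> cpoly" where
  "pd i f = (\<Sum>m\<in>Poly_Mapping.keys f.
     Poly_Mapping.single (m - Poly_Mapping.single i 1)
       (of_nat (Poly_Mapping.lookup m i) * Poly_Mapping.lookup f m))"

definition block_sum :: "(nat \<Rightarrow> nat) \<Rightarrow> nat set \<Rightarrow> nat" where
  "block_sum k B = (\<Sum>t\<in>B. k t)"

definition diff_factor :: "(nat \<Rightarrow> nat) \<Rightarrow> nat set \<Rightarrow> cpoly \<Rightarrow> cpoly" where
  "diff_factor k B f = pconst (of_nat (block_sum k B)) * pd (block_sum k B) f"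

text \<open>The fold is independent of the order of the factors by the lemma \<open>diff_factor_commute\<close> below.\<close>

definition summand :: "summation \<Rightarrow> (nat \<Rightarrow> nat) \<Rightarrow> cpoly \<Rightarrow> cpoly" where
  "summand S k f =
    (\<Prod>c\<in>poly_factors S. pvar (block_sum k c)) * Finite_Set.fold (diff_factor k) f (diff_factors S)"

text \<open>
  When the differential factors cover \<open>{1..n}\<close>, as they do for \<open>FS n \<alpha>\<close>, a given polynomial is
  annihilated by all but finitely many summands.
\<close>

definition summation_operator :: "summation \<Rightarrow> cpoly \<Rightarrow> cpoly" where
  "summation_operator S f =
    pconst (1 / of_nat (arity S)) *
    (\<Sum>k | k \<in> {1..arity S} \<rightarrow>\<^sub>E {1..} \<and> summand S k f \<noteq> 0. summand S k f)"

definition W_operator :: "nat \<Rightarrow> cpoly \<Rightarrow> cpoly" where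
  "W_operator n f = (\<Sum>\<alpha> | \<alpha> permutes {1..n}. summation_operator (FS n \<alpha>) f)"

lemma lookup_pd:
  "Poly_Mapping.lookup (pd i f) m =
    of_nat (Poly_Mapping.lookup m i + 1) * Poly_Mapping.lookup f (m + Poly_Mapping.single i 1)"
proof -
  let ?e = "Poly_Mapping.single i (1::nat)"
  have eq: "m' = m + ?e" if "m' - ?e = m" "Poly_Mapping.lookup m' i \<noteq> 0" for m'
  proof (rule poly_mapping_eqI)
    fix t
    have "Poly_Mapping.lookup m t = Poly_Mapping.lookup m' t - Poly_Mapping.lookup ?e t"
      using that(1) by (metis lookup_minus)
    then show "Poly_Mapping.lookup m' t = Poly_Mapping.lookup (m + ?e) t"
      using that(2) by (auto simp: lookup_add lookup_single when_def)
  qed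
  have "Poly_Mapping.lookup (pd i f) m =
      (\<Sum>m'\<in>Poly_Mapping.keys f. of_nat (Poly_Mapping.lookup m' i) * Poly_Mapping.lookup f m' when m' - ?e = m)"
    unfolding pd_def by (simp add: lookup_sum lookup_single)
  also have "\<dots> = (\<Sum>m'\<in>Poly_Mapping.keys f.
      if m' = m + ?e then of_nat (Poly_Mapping.lookup m' i) * Poly_Mapping.lookup f m' else 0)"
  proof (rule sum.cong[OF refl])
    fix m'
    have "m' - ?e = m" if "m' = m + ?e"
      unfolding that by (rule add_diff_cancel_right')
    then have "m' - ?e = m \<longleftrightarrow> m' = m + ?e" if "Poly_Mapping.lookup m' i \<noteq> 0"
      using eq that by blast
    then show "(of_nat (Poly_Mapping.lookup m' i) * Poly_Mapping.lookup f m' when m' - ?e = m) =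
      (if m' = m + ?e then of_nat (Poly_Mapping.lookup m' i) * Poly_Mapping.lookup f m' else 0)"
      by (cases "Poly_Mapping.lookup m' i = 0") (simp_all only: when_def, simp_all)
  qed
  also have "\<dots> = of_nat (Poly_Mapping.lookup m i + 1) * Poly_Mapping.lookup f (m + ?e)"
    by (simp add: sum.delta lookup_add lookup_single in_keys_iff)
  finally show ?thesis .
qed

lemma lookup_pconst_mult:
  "Poly_Mapping.lookup (pconst c * f) m = c * Poly_Mapping.lookup f m"
proof -
  have "pconst c * f = Poly_Mapping.map ((*) c) f"
    unfolding pconst_def by (simp add: mult_map_scale_conv_mult)
  then show ?thesis
    by (simp add: Poly_Mapping.map.rep_eq when_def)
qed

lemma diff_factor_commute:
  "diff_factor k B \<circ> diff_factor k C = diff_factor k C \<circ> diff_factor k B"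
proof (rule ext, rule poly_mapping_eqI)
  fix f m
  let ?b = "block_sum k B" and ?c = "block_sum k C"
  show "Poly_Mapping.lookup ((diff_factor k B \<circ> diff_factor k C) f) m =
      Poly_Mapping.lookup ((diff_factor k C \<circ> diff_factor k B) f) m"
  proof (cases "?b = ?c")
    case True
    then show ?thesis by (simp add: diff_factor_def)
  next
    case False
    have "m + Poly_Mapping.single ?b 1 + Poly_Mapping.single ?c 1 =
        m + Poly_Mapping.single ?c 1 + Poly_Mapping.single ?b 1"
      by (simp only: ac_simps)
    with False show ?thesis
      by (simp add: diff_factor_def lookup_pconst_mult lookup_pd lookup_add lookup_single)
  qed
qed

end

theory Submission
  imports Defs
begin

text \<open>
  The permutations of \<open>{1..n + 1}\<close> are the \<open>[\<alpha>, j]\<close>, and in product form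
  \<open>[\<alpha>, j] = (j n+1) \<circ> \<alpha> \<circ> (1 n+1)\<close>, where \<open>j = 0\<close> stands for \<open>n + 1\<close> (\<open>extend_eq\<close>).  Since a multiplication
  by a transposition splits a cycle or merges two cycles, the effect on the number of cycles (\<open>dP\<close>),
  the number of blocks (\<open>dD\<close>) and the length \<open>c\<close> of the cycle of \<open>1\<close> can be read off:

  \<^item> \<open>j = 0\<close>: one more block, the same number of cycles, and \<open>c\<close> grows by one (\<open>extend_0\<close>);
  \<^item> \<open>j\<close> is the element \<open>\<alpha>\<^sup>p 1\<close> of the cycle of \<open>1\<close>, \<open>1 \<le> p \<le> c\<close>: one more cycle, the same number of
    blocks, and \<open>c\<close> becomes \<open>c + 1 - p\<close> (\<open>extend_in_cycle\<close>);
  \<^item> \<open>j\<close> is in another cycle: one cycle less and the same number of blocks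
    (\<open>extend_outside_cycle\<close>).

  The degree starts at \<open>2\<close> for \<open>n = 1\<close>, so it is at most \<open>n + 1\<close>, and a summation is ordinary exactly if
  the third case never occurs in its construction.  Let \<open>N(n, c, r)\<close> be the number of ordinary
  summations with \<open>dP = r\<close> for which the cycle of \<open>1\<close> has length \<open>c\<close>.  The first two cases give
  \<open>N(n + 1, c, r + 1) = N(n, c - 1, r + 1) + (\<Sum>d=c..n. N(n, d, r))\<close> (\<open>card_ordinary_Suc\<close>), which is the
  recursion for Dyck paths by semilength, last descent and number of peaks.  It is solved by
  \<open>N(n, c, s + 1) = c / n \<cdot> C(n, s) \<cdot> C(n - c - 1, s - 1)\<close> for \<open>s \<ge> 1\<close> and \<open>c < n\<close> (\<open>card_ordinary\<close>), and summation
  over \<open>c\<close> gives the Narayana numbers (\<open>card_ordinary_type\<close>).  Their sum is a Catalan number by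
  Vandermonde's convolution (\<open>sum_narayana\<close>).
\<close>

section \<open>Products of permutations with transpositions\<close>

lemma orbit_eq_of_mem:
  assumes "permutation f" "y \<in> orbit f x"
  shows "orbit f y = orbit f x"
  using assms by (intro orbit_cyclic_eq3 cyclic_on_orbit')

lemma orbit_of_cyclic_sequence:
  assumes "\<And>i. Suc i < l \<Longrightarrow> g (h i) = h (Suc i)" and "g (h (l - 1)) = h 0" and "0 < l"
  shows "orbit g (h 0) = h ` {..<l}"
proof -
  have pow: "(g ^^ i) (h 0) = h i" if "i < l" for i
    using that by (induction i) (auto simp: assms(1))
  have "(g ^^ l) (h 0) = g ((g ^^ (l - 1)) (h 0))"
    using \<open>0 < l\<close> by (cases l) auto
  also have "\<dots> = h 0" using pow[of "l - 1"] assms(2,3) by simp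
  finally have "orbit g (h 0) = {(g ^^ i) (h 0) | i. i < l}"
    using \<open>0 < l\<close> by (rule orbit_altdef_bounded)
  also have "\<dots> = h ` {..<l}" using pow by force
  finally show ?thesis .
qed

text \<open>
  Orbits are handled through the list \<open>a, f a, f (f a), \<dots>\<close>, which runs through the orbit of \<open>a\<close>
  without repetition and returns to \<open>a\<close>.  Cutting and concatenating such lists is what a
  multiplication by a transposition does.
\<close>

lemma orbit_enumeration:
  assumes "permutation f"
  shows "orbit f a = (\<lambda>i. (f ^^ i) a) ` {..<card (orbit f a)}"
    and "inj_on (\<lambda>i. (f ^^ i) a) {..<card (orbit f a)}"
    and "(f ^^ card (orbit f a)) a = a"
    and "0 < card (orbit f a)"
proof -
  let ?m = "funpow_dist1 f a a"
  have self: "a \<in> orbit f a" using assms by (rule permutation_self_in_orbit)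
  have o: "orbit f a = (\<lambda>i. (f ^^ i) a) ` {..<?m}"
    using orbit_conv_funpow_dist1[OF self] by (simp add: lessThan_atLeast0)
  have i: "inj_on (\<lambda>i. (f ^^ i) a) {..<?m}"
    using inj_on_funpow_dist1[OF self] by (simp add: lessThan_atLeast0)
  have c: "card (orbit f a) = ?m" using card_image[OF i] o by simp
  show "orbit f a = (\<lambda>i. (f ^^ i) a) ` {..<card (orbit f a)}"
    "inj_on (\<lambda>i. (f ^^ i) a) {..<card (orbit f a)}"
    "(f ^^ card (orbit f a)) a = a" "0 < card (orbit f a)"
    unfolding c using o i funpow_dist1_prop[OF self] by simp_all
qed

text \<open>
  The same list started at \<open>f a\<close>, with \<open>a\<close> itself reached last.  In this order the element at
  position \<open>p\<close> of the cycle of \<open>1\<close> is \<open>\<alpha>\<^sup>p 1\<close> with \<open>1 \<le> p \<le> c\<close>, so that the last position belongs to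
  \<open>1\<close>.
\<close>

lemma orbit_enumeration_from_1:
  assumes "permutation f"
  shows "orbit f a = (\<lambda>i. (f ^^ i) a) ` {1..card (orbit f a)}"
proof -
  let ?c = "card (orbit f a)"
  note e = orbit_enumeration[OF assms, of a]
  have "(f ^^ i) a \<in> (\<lambda>i. (f ^^ i) a) ` {1..?c}" if "i < ?c" for i
  proof (cases "i = 0")
    case True
    then show ?thesis using e(3,4) by (intro image_eqI[of _ _ ?c]) auto
  qed (use that in auto)
  then have "orbit f a \<subseteq> (\<lambda>i. (f ^^ i) a) ` {1..?c}"
    by (intro ord_eq_le_trans[OF e(1)] image_subsetI) simp
  moreover have "(\<lambda>i. (f ^^ i) a) ` {1..?c} \<subseteq> orbit f a" by (auto simp: orbit_altdef)
  ultimately show ?thesis by (rule subset_antisym)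
qed

text \<open>
  Swapping the values \<open>a\<close> and \<open>b\<close> redirects the two arrows that end there: the arrow into
  \<open>b = f\<^sup>k a\<close> now closes up the first \<open>k\<close> elements of the cycle, and the arrow into \<open>a\<close> closes up the
  remaining ones.
\<close>

lemma orbit_transpose_split:
  assumes f: "permutation f" and k: "0 < k" "k < card (orbit f a)" and b: "b = (f ^^ k) a"
  defines "g \<equiv> Transposition.transpose a b \<circ> f"
  shows "orbit g a = (\<lambda>i. (f ^^ i) a) ` {..<k}"
    and "orbit g b = (\<lambda>i. (f ^^ i) a) ` {k..<card (orbit f a)}"
proof -
  let ?m = "card (orbit f a)" and ?h = "\<lambda>i. (f ^^ i) a"
  note e = orbit_enumeration[OF f, of a]
  have neq: "?h i \<noteq> ?h j" if "i < ?m" "j < ?m" "i \<noteq> j" for i j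
    using e(2) that by (auto simp: inj_on_def)
  have g_step: "g (?h i) = ?h (Suc i)" if "Suc i < ?m" "Suc i \<noteq> k" for i
    using neq[of "Suc i" 0] neq[of "Suc i" k] that k by (simp add: g_def b)
  have "g (?h (k - 1)) = ?h 0"
    using k(1) by (cases k) (simp_all add: g_def b)
  then show "orbit g a = ?h ` {..<k}"
    using orbit_of_cyclic_sequence[of k g ?h] g_step k by auto
  have "f (?h (?m - 1)) = a" using e(3,4) by (cases ?m) auto
  then have "g (?h (k + (?m - k - 1))) = ?h (k + 0)"
    using k by (simp add: g_def b)
  then have "orbit g (?h (k + 0)) = (\<lambda>i. ?h (k + i)) ` {..<?m - k}"
    using g_step k by (intro orbit_of_cyclic_sequence) auto
  also have "\<dots> = ?h ` ((+) k ` {..<?m - k})" by (simp add: image_image)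
  also have "(+) k ` {..<?m - k} = {k..<?m}"
    using k by (simp add: lessThan_atLeast0)
  finally show "orbit g b = ?h ` {k..<?m}" by (simp add: b)
qed

text \<open>
  Apart from the cycle that is cut in two, all cycles avoid \<open>a\<close> and \<open>b\<close> and therefore survive.
\<close>

lemma card_orbits_transpose_split:
  assumes f: "f permutes S" "finite S" and "a \<in> S" "b \<in> orbit f a" "a \<noteq> b"
  shows "card (orbit (Transposition.transpose a b \<circ> f) ` S) = Suc (card (orbit f ` S))"
proof -
  let ?m = "card (orbit f a)" and ?h = "\<lambda>i. (f ^^ i) a"
  define g where "g = Transposition.transpose a b \<circ> f"
  have pf: "permutation f" using f by (auto simp: permutation_permutes)
  have "b \<in> S" using permutes_orbit_subset[OF f(1) \<open>a \<in> S\<close>] assms by auto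
  have "g permutes S" unfolding g_def
    using f \<open>a \<in> S\<close> \<open>b \<in> S\<close> by (intro permutes_compose permutes_swap_id)
  then have pg: "permutation g" using f(2) by (auto simp: permutation_permutes)
  note e = orbit_enumeration[OF pf, of a]
  obtain k where k: "k < ?m" "b = ?h k" using e(1) assms(4) by blast
  have "0 < k" using k(2) \<open>a \<noteq> b\<close> by (cases k) auto
  have oa: "orbit g a = ?h ` {..<k}" and ob: "orbit g b = ?h ` {k..<?m}"
    unfolding g_def by (rule orbit_transpose_split[OF pf \<open>0 < k\<close> k])+
  have "{..<?m} = {..<k} \<union> {k..<?m}" using k by auto
  then have un: "orbit f a = orbit g a \<union> orbit g b"
    unfolding oa ob using e(1) by (metis image_Un)
  have "a \<notin> orbit g b"
  proof
    assume "a \<in> orbit g b"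
    then obtain i where "k \<le> i" "i < ?m" "?h i = ?h 0" unfolding ob by auto
    then have "i = 0" using inj_onD[OF e(2), of i 0] e(4) by simp
    then show False using \<open>k \<le> i\<close> \<open>0 < k\<close> by simp
  qed
  then have ne: "orbit g a \<noteq> orbit g b" using permutation_self_in_orbit[OF pg, of a] by auto
  have out: "orbit g x = orbit f x" if "x \<notin> orbit f a" for x
  proof (rule orbit_cong)
    show "x \<in> orbit f x" using pf by (rule permutation_self_in_orbit)
    fix s assume s: "s \<in> orbit f x"
    have "f s \<notin> orbit f a"
    proof
      assume "f s \<in> orbit f a"
      moreover have "f s \<in> orbit f x" using s by (rule orbit.step)
      ultimately have "orbit f a = orbit f x" using orbit_eq_of_mem[OF pf] by metis
      then show False using that permutation_self_in_orbit[OF pf, of x] by simp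
    qed
    then have "f s \<noteq> a" "f s \<noteq> b" using assms(4) permutation_self_in_orbit[OF pf, of a] by auto
    then show "g s = f s" by (simp add: g_def)
  qed
  have inn: "orbit g x = orbit g a \<or> orbit g x = orbit g b" if "x \<in> orbit f a" for x
    using that orbit_eq_of_mem[OF pg] unfolding un by blast
  have eq: "orbit g ` S = insert (orbit g a) (insert (orbit g b) (orbit f ` S - {orbit f a}))"
    (is "_ = ?R")
  proof
    show "orbit g ` S \<subseteq> ?R"
    proof (rule image_subsetI)
      fix x assume "x \<in> S"
      show "orbit g x \<in> ?R"
      proof (cases "x \<in> orbit f a")
        case True then show ?thesis using inn by blast
      next
        case False
        then have "orbit f x \<noteq> orbit f a" using permutation_self_in_orbit[OF pf, of x] by auto
        then show ?thesis using out[OF False] \<open>x \<in> S\<close> by auto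
      qed
    qed
    show "?R \<subseteq> orbit g ` S"
    proof -
      have "orbit f x \<in> orbit g ` S" if "x \<in> S" "orbit f x \<noteq> orbit f a" for x
      proof -
        have "x \<notin> orbit f a" using that(2) orbit_eq_of_mem[OF pf] by blast
        then show ?thesis using out that(1) by (metis image_eqI)
      qed
      then show ?thesis using \<open>a \<in> S\<close> \<open>b \<in> S\<close> by auto
    qed
  qed
  have new: "orbit g x \<notin> orbit f ` S - {orbit f a}" if "x = a \<or> x = b" for x
  proof
    assume "orbit g x \<in> orbit f ` S - {orbit f a}"
    then obtain y where y: "orbit g x = orbit f y" "orbit f y \<noteq> orbit f a" by auto
    have "x \<in> orbit f y" using y(1) permutation_self_in_orbit[OF pg, of x] by auto
    moreover have "x \<in> orbit f a" using that assms(4) permutation_self_in_orbit[OF pf, of a] by auto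
    ultimately show False using y(2) orbit_eq_of_mem[OF pf] by metis
  qed
  have "card (orbit g ` S) = Suc (Suc (card (orbit f ` S - {orbit f a})))"
    unfolding eq using new[of a] new[of b] ne f(2) by simp
  also have "Suc (card (orbit f ` S - {orbit f a})) = card (orbit f ` S)"
    using \<open>a \<in> S\<close> f(2) by (intro card_Suc_Diff1) auto
  finally show ?thesis unfolding g_def .
qed

text \<open>
  Following \<open>g = (a b) \<circ> f\<close> from \<open>b\<close> one runs through the \<open>f\<close>-cycle of \<open>b\<close>, and the arrow that used to
  return to \<open>b\<close> leads to \<open>a\<close>.  So \<open>a\<close> and \<open>b\<close> share a \<open>g\<close>-cycle, and since \<open>f = (a b) \<circ> g\<close>, the passage
  from \<open>g\<close> back to \<open>f\<close> is a split.
\<close>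

lemma card_orbits_transpose_merge:
  assumes f: "f permutes S" "finite S" and "a \<in> S" "b \<in> S" "b \<notin> orbit f a"
  shows "Suc (card (orbit (Transposition.transpose a b \<circ> f) ` S)) = card (orbit f ` S)"
proof -
  let ?l = "card (orbit f b)" and ?h = "\<lambda>i. (f ^^ i) b"
  define g where "g = Transposition.transpose a b \<circ> f"
  have pf: "permutation f" using f by (auto simp: permutation_permutes)
  have g: "g permutes S" unfolding g_def
    using f assms by (intro permutes_compose permutes_swap_id)
  then have pg: "permutation g" using f(2) by (auto simp: permutation_permutes)
  have ab: "a \<noteq> b" using assms(5) permutation_self_in_orbit[OF pf] by auto
  have "a \<notin> orbit f b"
    using assms(5) orbit_eq_of_mem[OF pf] permutation_self_in_orbit[OF pf] by metis
  note e = orbit_enumeration[OF pf, of b]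
  have pow: "(g ^^ i) b = ?h i" if "i < ?l" for i
    using that
  proof (induction i)
    case (Suc i)
    have "?h (Suc i) \<noteq> ?h 0" using inj_onD[OF e(2), of "Suc i" 0] Suc.prems by auto
    moreover have "?h (Suc i) \<noteq> a"
      using \<open>a \<notin> orbit f b\<close> e(1) Suc.prems by blast
    ultimately show ?case using Suc by (simp add: g_def)
  qed simp
  have "f ((f ^^ (?l - 1)) b) = b" using e(3,4) by (cases ?l) auto
  then have "g ((g ^^ (?l - 1)) b) = a" using pow[of "?l - 1"] e(4) by (simp add: g_def)
  then have "a \<in> orbit g b"
    using funpow_in_orbit[OF permutation_self_in_orbit[OF pg]] by (metis orbit.step)
  then have "b \<in> orbit g a"
    using orbit_eq_of_mem[OF pg] permutation_self_in_orbit[OF pg] by metis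
  from card_orbits_transpose_split[OF g f(2) \<open>a \<in> S\<close> this ab]
  show ?thesis by (simp add: g_def comp_assoc[symmetric] fun.map_ident del: o_apply)
qed

section \<open>The permutations \<open>[\<alpha>, j]\<close> and their partitions\<close>

text \<open>
  Replacing the source \<open>1\<close> by \<open>n + 1\<close> is precomposition with the transposition \<open>(1 n+1)\<close>, so the quiver
  is the graph of a function on \<open>{2..n + 1}\<close>.
\<close>

lemma quiver_iff:
  assumes "1 \<le> n"
  shows "(x, y) \<in> quiver n \<alpha> \<longleftrightarrow>
    x \<in> {2..n + 1} \<and> y = (\<alpha> \<circ> Transposition.transpose 1 (n + 1)) x"
proof (cases "x = n + 1")
  case True
  then show ?thesis using assms by (auto simp: quiver_def)
next
  case False
  then show ?thesis using assms
    by (cases "2 \<le> x") (auto simp: quiver_def transpose_apply_other)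
qed

lemma quiver_inject:
  assumes "1 \<le> n" "\<alpha> permutes {1..n}" "\<alpha>' permutes {1..n}" "quiver n \<alpha> = quiver n \<alpha>'"
  shows "\<alpha> = \<alpha>'"
proof
  fix x
  show "\<alpha> x = \<alpha>' x"
  proof (cases "x \<in> {1..n}")
    case True
    define y where "y = Transposition.transpose 1 (n + 1) x"
    have y: "y \<in> {2..n + 1}" "Transposition.transpose 1 (n + 1) y = x"
      using True assms(1) by (auto simp: y_def Transposition.transpose_def)
    then have "(y, \<alpha> x) \<in> quiver n \<alpha>" using quiver_iff[OF assms(1)] by simp
    then show ?thesis unfolding assms(4) quiver_iff[OF assms(1)] using y by simp
  next
    case False
    then show ?thesis using assms(2,3) by (simp add: permutes_not_in)
  qed
qed

text \<open>
  The value of \<open>[\<alpha>, j]\<close> at \<open>1\<close>, that is, the target of the new arrow from \<open>n + 2\<close>.  Reading \<open>j = 0\<close> as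
  \<open>n + 1\<close> makes the two cases of the construction into one.
\<close>

definition extend_target :: "nat \<Rightarrow> nat \<Rightarrow> nat" where
  "extend_target n j = (if j = 0 then n + 1 else j)"

text \<open>
  The group-theoretic form of \<open>[\<alpha>, j]\<close>.  Right multiplication by \<open>(1 n+1)\<close> inserts \<open>n + 1\<close> after \<open>1\<close>
  in its cycle, which is \<open>[\<alpha>, 0]\<close>; left multiplication by \<open>(j n+1)\<close> then exchanges the targets \<open>j\<close>
  and \<open>n + 1\<close> of two arrows, which is exactly the rerouting of \<open>i \<rightarrow> j\<close> and \<open>n + 2 \<rightarrow> n + 1\<close>.
\<close>

lemma extend_eq:
  assumes n: "1 \<le> n" and \<alpha>: "\<alpha> permutes {1..n}" and j: "j \<le> n"
  shows "extend n \<alpha> j =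
      Transposition.transpose (extend_target n j) (n + 1) \<circ> (\<alpha> \<circ> Transposition.transpose 1 (n + 1))"
    (is "_ = ?t \<circ> ?\<sigma>")
    and "extend n \<alpha> j permutes {1..n + 1}"
proof -
  let ?\<beta> = "?t \<circ> ?\<sigma>"
  have \<alpha>': "\<alpha> permutes {1..n + 1}" using \<alpha> by (rule permutes_subset) auto
  have \<sigma>: "?\<sigma> permutes {1..n + 1}"
    by (rule permutes_compose[OF permutes_swap_id \<alpha>']) (use n in auto)
  have \<beta>: "?\<beta> permutes {1..n + 1}"
    by (rule permutes_compose[OF \<sigma> permutes_swap_id]) (use n j in \<open>auto simp: extend_target_def\<close>)
  have \<sigma>1: "?\<sigma> 1 = n + 1" using \<alpha> by (simp add: permutes_not_in)
  have \<sigma>x: "?\<sigma> x \<noteq> n + 1" if "x \<noteq> 1" for x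
    using \<sigma>1 that permutes_inj[OF \<sigma>] by (metis injD)
  have Q: "(x, y) \<in> quiver (n + 1) ?\<beta> \<longleftrightarrow>
      x = n + 2 \<and> y = extend_target n j \<or> x \<in> {2..n + 1} \<and> y = ?t (?\<sigma> x)" for x y
  proof (cases "x = n + 2")
    case True
    then show ?thesis using \<sigma>1 by (simp add: quiver_iff)
  next
    case False
    then show ?thesis
      by (cases "x = 1") (auto simp: quiver_iff transpose_apply_other)
  qed
  have "quiver (n + 1) ?\<beta> = extend_quiver n (quiver n \<alpha>) j"
  proof (cases "j = 0")
    case True
    have "(x, y) \<in> quiver (n + 1) ?\<beta> \<longleftrightarrow> (x, y) \<in> extend_quiver n (quiver n \<alpha>) j" for x y
      unfolding Q using True quiver_iff[OF n]
      by (auto simp: extend_quiver_def extend_target_def)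
    then show ?thesis by (intro set_eqI) (simp add: split_paired_all)
  next
    case False
    \<comment> \<open>the source of the unique arrow into \<open>j\<close>\<close>
    define i where "i = inv ?\<sigma> j"
    have i: "?\<sigma> i = j" unfolding i_def using permutes_inverses(1)[OF \<sigma>] by simp
    have iff: "?\<sigma> x = j \<longleftrightarrow> x = i" for x
      using i permutes_inj[OF \<sigma>] by (metis injD)
    have "i \<noteq> 1" using i \<sigma>1 j by auto
    moreover have "i \<in> {1..n + 1}"
      using permutes_in_image[OF \<sigma>, of i] i False j by simp
    ultimately have i_mem: "i \<in> {2..n + 1}" by auto
    have "(THE i. (i, j) \<in> quiver n \<alpha>) = i"
      unfolding quiver_iff[OF n] using i_mem iff by (intro the_equality) metis+
    then have E: "extend_quiver n (quiver n \<alpha>) j = quiver n \<alpha> - {(i, j)} \<union> {(n + 2, j), (i, n + 1)}"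
      using False by (simp add: extend_quiver_def)
    have "(x, y) \<in> quiver (n + 1) ?\<beta> \<longleftrightarrow> (x, y) \<in> extend_quiver n (quiver n \<alpha>) j" for x y
    proof (cases "x \<in> {2..n + 1}")
      case True
      show ?thesis
      proof (cases "x = i")
        case True
        then show ?thesis unfolding Q E Un_iff Diff_iff quiver_iff[OF n]
          using i i_mem False by (auto simp: extend_target_def)
      next
        case x: False
        then have "?t (?\<sigma> x) = ?\<sigma> x"
          using iff[of x] \<sigma>x[of x] True False
          by (intro transpose_apply_other) (auto simp: extend_target_def)
        then show ?thesis unfolding Q E Un_iff Diff_iff quiver_iff[OF n]
          using x True by auto
      qed
    next
      case x: False
      then show ?thesis unfolding Q E Un_iff Diff_iff quiver_iff[OF n]
        using i_mem False by (auto simp: extend_target_def)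
    qed
    then show ?thesis by (intro set_eqI) (simp add: split_paired_all)
  qed
  then have "extend n \<alpha> j = ?\<beta>" unfolding extend_def
    using \<beta> quiver_inject[of "n + 1"] by (intro the_equality) auto
  then show "extend n \<alpha> j = ?\<beta>" and "extend n \<alpha> j permutes {1..n + 1}"
    using \<beta> by simp_all
qed

text \<open>
  The value at \<open>1\<close> determines \<open>j\<close>, and then \<open>\<alpha>\<close> is recovered by cancelling both transpositions.
\<close>

lemma extend_inject:
  assumes "1 \<le> n" "\<alpha> permutes {1..n}" "\<alpha>' permutes {1..n}" "j \<le> n" "j' \<le> n"
    and eq: "extend n \<alpha> j = extend n \<alpha>' j'"
  shows "\<alpha> = \<alpha>' \<and> j = j'"
proof -
  have at_1: "extend n \<gamma> i 1 = extend_target n i" if "\<gamma> permutes {1..n}" "i \<le> n" for \<gamma> i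
    using that assms(1) by (simp add: extend_eq permutes_not_in)
  have "extend_target n j = extend_target n j'"
    using at_1[OF assms(2,4)] at_1[OF assms(3,5)] eq by simp
  then have j: "j = j'" using assms(4,5) by (auto simp: extend_target_def split: if_splits)
  let ?t = "Transposition.transpose (extend_target n j) (n + 1)"
  let ?s = "Transposition.transpose 1 (n + 1)"
  have "?t \<circ> (\<alpha> \<circ> ?s) = ?t \<circ> (\<alpha>' \<circ> ?s)" using eq assms j by (simp add: extend_eq)
  then have "?t \<circ> (?t \<circ> (\<alpha> \<circ> ?s)) \<circ> ?s = ?t \<circ> (?t \<circ> (\<alpha>' \<circ> ?s)) \<circ> ?s" by simp
  then have "\<alpha> = \<alpha>'" by (simp add: fun_eq_iff)
  with j show ?thesis by simp
qed

lemma extend_surj: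
  assumes n: "1 \<le> n" and \<beta>: "\<beta> permutes {1..n + 1}"
  obtains \<alpha> j where "\<alpha> permutes {1..n}" "j \<le> n" "\<beta> = extend n \<alpha> j"
proof -
  let ?t = "Transposition.transpose (\<beta> 1) (n + 1)"
  let ?s = "Transposition.transpose 1 (n + 1)"
  define \<alpha> where "\<alpha> = ?t \<circ> (\<beta> \<circ> ?s)"
  define j where "j = (if \<beta> 1 = n + 1 then 0 else \<beta> 1)"
  have \<beta>1: "\<beta> 1 \<in> {1..n + 1}" unfolding permutes_in_image[OF \<beta>] by simp
  have "\<alpha> permutes {1..n + 1}" unfolding \<alpha>_def
    by (rule permutes_compose[OF permutes_compose[OF permutes_swap_id \<beta>] permutes_swap_id])
      (use \<beta>1 in auto)
  moreover have "\<alpha> x = x" if "x \<in> {1..n + 1} - {1..n}" for x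
  proof -
    have "x = n + 1" using that by auto
    then show ?thesis by (simp add: \<alpha>_def)
  qed
  ultimately have \<alpha>: "\<alpha> permutes {1..n}"
    by (rule permutes_superset)
  have j: "j \<le> n" "extend_target n j = \<beta> 1"
    using \<beta>1 by (auto simp: j_def extend_target_def)
  have "extend n \<alpha> j = ?t \<circ> (\<alpha> \<circ> ?s)" using extend_eq(1)[OF n \<alpha> j(1)] j(2) by simp
  also have "\<dots> = \<beta>" by (simp add: \<alpha>_def fun_eq_iff)
  finally show ?thesis using that[OF \<alpha> j(1)] by simp
qed

lemma unextend_extend:
  assumes "1 \<le> n" "\<alpha> permutes {1..n}" "j \<le> n"
  shows "unextend n (extend n \<alpha> j) = (\<alpha>, j)"
  unfolding unextend_def
proof (rule the_equality)
  show "case (\<alpha>, j) of (\<alpha>', j') \<Rightarrow> \<alpha>' permutes {1..n} \<and> j' \<le> n \<and> extend n \<alpha>' j' = extend n \<alpha> j"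
    using assms by simp
  fix x
  assume "case x of (\<alpha>', j') \<Rightarrow> \<alpha>' permutes {1..n} \<and> j' \<le> n \<and> extend n \<alpha>' j' = extend n \<alpha> j"
  then show "x = (\<alpha>, j)"
    using extend_inject[OF assms(1) _ assms(2) _ assms(3)] by (cases x) blast
qed

lemma perm_partition_extend:
  assumes "1 \<le> n" "\<alpha> permutes {1..n}" "j \<le> n"
  shows "perm_partition (n + 1) (extend n \<alpha> j) =
    (if j = 0 then perm_partition n \<alpha> \<union> {{n + 1}}
     else (\<lambda>B. if j \<in> B then insert (n + 1) B else B) ` perm_partition n \<alpha>)"
proof -
  obtain m where "n = Suc m" using assms(1) by (cases n) auto
  then show ?thesis using unextend_extend[OF assms] by (simp add: Let_def)
qed

lemma perm_partition_subset:
  assumes "1 \<le> n" "\<alpha> permutes {1..n}"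
  shows "perm_partition n \<alpha> \<subseteq> Pow {1..n}"
  using assms
proof (induction n arbitrary: \<alpha> rule: nat_induct_at_least)
  case base
  then show ?case by simp
next
  case (Suc n)
  have "\<alpha> permutes {1..n + 1}" using Suc.prems by simp
  then obtain \<alpha>' j where "\<alpha>' permutes {1..n}" "j \<le> n" "\<alpha> = extend n \<alpha>' j"
    by (rule extend_surj[OF Suc.hyps])
  then have "B \<subseteq> {1..Suc n}" if "B \<in> perm_partition (Suc n) \<alpha>" for B
    using that perm_partition_extend[of n \<alpha>' j] Suc.IH[of \<alpha>'] Suc.hyps
    by (fastforce split: if_splits)
  then show ?case by blast
qed

text \<open>
  No block of the old partition contains \<open>n + 1\<close>; so \<open>{n + 1}\<close> is a new block, and enlarging the
  blocks that contain \<open>j\<close> identifies no two blocks.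
\<close>

lemma dD_extend:
  assumes "1 \<le> n" "\<alpha> permutes {1..n}" "j \<le> n"
  shows "dD (FS (n + 1) (extend n \<alpha> j)) = dD (FS n \<alpha>) + (if j = 0 then 1 else 0)"
proof -
  let ?P = "perm_partition n \<alpha>"
  have sub: "?P \<subseteq> Pow {1..n}" using assms by (intro perm_partition_subset)
  then have fin: "finite ?P" by (rule finite_subset) simp
  have notin: "n + 1 \<notin> B" if "B \<in> ?P" for B using sub that by fastforce
  then have "{n + 1} \<notin> ?P" by auto
  moreover have "inj_on (\<lambda>B. if j \<in> B then insert (n + 1) B else B) ?P"
  proof (rule inj_onI)
    fix B C assume "B \<in> ?P" "C \<in> ?P"
      and eq: "(if j \<in> B then insert (n + 1) B else B) = (if j \<in> C then insert (n + 1) C else C)"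
    then have "n + 1 \<notin> B" "n + 1 \<notin> C" using notin by auto
    with eq show "B = C" by (metis insert_ident insertI1)
  qed
  ultimately show ?thesis
    unfolding dD_def FS_def summation.sel perm_partition_extend[OF assms]
    using fin by (cases "j = 0") (simp_all only: if_True if_False card_image, simp_all)
qed

section \<open>The effect of an extension on the cycles\<close>

text \<open>
  By the product formula for \<open>[\<alpha>, j]\<close>, the step from \<open>\<alpha>\<close> to \<open>[\<alpha>, j]\<close> passes through
  \<open>\<sigma> = [\<alpha>, 0]\<close>, in which \<open>n + 1\<close> has joined the cycle of \<open>1\<close>.
\<close>

context
  fixes n :: nat and \<alpha> :: "nat \<Rightarrow> nat"
  assumes n: "1 \<le> n" and \<alpha>: "\<alpha> permutes {1..n}"
begin

private abbreviation "\<sigma> \<equiv> \<alpha> \<circ> Transposition.transpose 1 (n + 1)"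

private lemma perm: "permutation \<alpha>" "permutation \<sigma>" "\<sigma> permutes {1..n + 1}"
proof -
  show "permutation \<alpha>" using \<alpha> by (auto simp: permutation_permutes)
  have "\<alpha> permutes {1..n + 1}" using \<alpha> by (rule permutes_subset) auto
  then show "\<sigma> permutes {1..n + 1}"
    by (intro permutes_compose permutes_swap_id) (use n in auto)
  then show "permutation \<sigma>" by (auto simp: permutation_permutes)
qed

lemma orbit_1_subset: "orbit \<alpha> 1 \<subseteq> {1..n}"
  using n by (intro permutes_orbit_subset[OF \<alpha>]) auto

text \<open>
  The cycle of \<open>1\<close> under \<open>\<sigma>\<close>, started at \<open>n + 1\<close>, is \<open>n + 1, \<alpha> 1, \<alpha>\<^sup>2 1, \<dots>, 1\<close>.
\<close>

private lemma funpow_insert: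
  assumes "1 \<le> p" "p \<le> card (orbit \<alpha> 1)"
  shows "(\<sigma> ^^ p) (n + 1) = (\<alpha> ^^ p) 1"
  using assms
proof (induction p rule: nat_induct_at_least)
  case base
  then show ?case by simp
next
  case (Suc p)
  note e = orbit_enumeration[OF perm(1), of 1]
  have "(\<alpha> ^^ p) 1 \<noteq> 1" using inj_onD[OF e(2), of p 0] Suc by auto
  moreover have "(\<alpha> ^^ p) 1 \<noteq> n + 1"
    using funpow_in_orbit[OF permutation_self_in_orbit[OF perm(1)], of p 1] orbit_1_subset by auto
  ultimately show ?case using Suc by (simp add: transpose_apply_other)
qed

private lemma orbit_insert: "orbit \<sigma> (n + 1) = insert (n + 1) (orbit \<alpha> 1)"
proof -
  let ?c = "card (orbit \<alpha> 1)"
  note e = orbit_enumeration[OF perm(1), of 1]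
  have pc: "(\<sigma> ^^ ?c) (n + 1) = 1" using funpow_insert[of ?c] e(3,4) by simp
  have "\<sigma> ((\<sigma> ^^ ?c) (n + 1)) = n + 1" unfolding pc using \<alpha> by (simp add: permutes_not_in)
  then have "orbit \<sigma> ((\<sigma> ^^ 0) (n + 1)) = (\<lambda>i. (\<sigma> ^^ i) (n + 1)) ` {..<Suc ?c}"
    by (intro orbit_of_cyclic_sequence) auto
  also have "{..<Suc ?c} = insert 0 {1..?c}" by auto
  also have "(\<lambda>i. (\<sigma> ^^ i) (n + 1)) ` \<dots> = insert (n + 1) ((\<lambda>i. (\<alpha> ^^ i) 1) ` {1..?c})"
    using funpow_insert by (simp del: comp_apply)
  also have "(\<lambda>i. (\<alpha> ^^ i) 1) ` {1..?c} = orbit \<alpha> 1"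
    by (rule orbit_enumeration_from_1[OF perm(1), symmetric])
  finally show ?thesis unfolding funpow_0 .
qed

private lemma card_orbit_insert: "card (orbit \<sigma> (n + 1)) = Suc (card (orbit \<alpha> 1))"
  using orbit_1_subset finite_subset[OF orbit_1_subset] unfolding orbit_insert
  by (subst card_insert_disjoint) auto

text \<open>
  On \<open>{1..n + 1}\<close> the permutation \<open>\<alpha>\<close> has one additional fixed point, and it arises from \<open>\<sigma>\<close> by
  splitting that point off again.
\<close>

private lemma card_cycles_insert: "card (orbit \<sigma> ` {1..n + 1}) = card (orbit \<alpha> ` {1..n})"
proof -
  let ?t = "Transposition.transpose (n + 1) (\<alpha> 1)"
  have t: "?t \<circ> \<sigma> = \<alpha>"
  proof
    fix x
    have out: "\<alpha> (n + 1) = n + 1" using \<alpha> by (simp add: permutes_not_in)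
    show "(?t \<circ> \<sigma>) x = \<alpha> x"
    proof (cases "x = 1 \<or> x = n + 1")
      case True
      then show ?thesis using out by auto
    next
      case False
      then have "\<alpha> x \<noteq> \<alpha> 1" "\<alpha> x \<noteq> \<alpha> (n + 1)" using permutes_inj[OF \<alpha>] by (auto dest: injD)
      then show ?thesis using False out by (simp add: transpose_apply_other)
    qed
  qed
  have "\<alpha> 1 \<in> orbit \<alpha> 1" by (rule orbit.base)
  then have "\<alpha> 1 \<in> orbit \<sigma> (n + 1)" "n + 1 \<noteq> \<alpha> 1"
    unfolding orbit_insert using orbit_1_subset by auto
  from card_orbits_transpose_split[OF perm(3) _ _ this]
  have "card (orbit \<alpha> ` {1..n + 1}) = Suc (card (orbit \<sigma> ` {1..n + 1}))"
    unfolding t by simp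
  moreover have "{1..n + 1} = insert (n + 1) {1..n}" by auto
  moreover have "orbit \<alpha> (n + 1) = {n + 1}"
    unfolding orbit_eq_singleton_iff using \<alpha> by (simp add: permutes_not_in)
  moreover have "{n + 1} \<notin> orbit \<alpha> ` {1..n}"
    using permutes_orbit_subset[OF \<alpha>] by fastforce
  ultimately show ?thesis by simp
qed

lemma extend_0:
  "dP (FS (n + 1) (extend n \<alpha> 0)) = dP (FS n \<alpha>)"
  "card (orbit (extend n \<alpha> 0) 1) = Suc (card (orbit \<alpha> 1))"
proof -
  have e: "extend n \<alpha> 0 = \<sigma>" using extend_eq(1)[OF n \<alpha>, of 0] by (simp add: extend_target_def)
  show "dP (FS (n + 1) (extend n \<alpha> 0)) = dP (FS n \<alpha>)"
    unfolding e using card_cycles_insert by (simp add: dP_def FS_def cycle_supports_def)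
  have "1 \<in> orbit \<sigma> (n + 1)"
    unfolding orbit_insert using permutation_self_in_orbit[OF perm(1)] by simp
  then show "card (orbit (extend n \<alpha> 0) 1) = Suc (card (orbit \<alpha> 1))"
    unfolding e using orbit_eq_of_mem[OF perm(2)] card_orbit_insert by metis
qed

private lemma extend_pos:
  assumes "1 \<le> j" "j \<le> n"
  shows "extend n \<alpha> j = Transposition.transpose (n + 1) j \<circ> \<sigma>"
  using extend_eq(1)[OF n \<alpha>, of j] assms by (simp add: extend_target_def transpose_commute)

text \<open>
  The transposition \<open>(n+1 j)\<close> cuts the cycle \<open>n + 1, \<alpha> 1, \<dots>, 1\<close> of length \<open>c + 1\<close> at position \<open>p\<close>.
  The part from \<open>j\<close> onwards ends with \<open>1\<close>; it is the new cycle of \<open>1\<close>, of length \<open>c + 1 - p\<close>.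
\<close>

lemma extend_in_cycle:
  assumes p: "1 \<le> p" "p \<le> card (orbit \<alpha> 1)"
  defines "j \<equiv> (\<alpha> ^^ p) 1"
  shows "j \<in> {1..n}"
    and "dP (FS (n + 1) (extend n \<alpha> j)) = Suc (dP (FS n \<alpha>))"
    and "card (orbit (extend n \<alpha> j) 1) = card (orbit \<alpha> 1) + 1 - p"
proof -
  let ?c = "card (orbit \<alpha> 1)"
  note e = orbit_enumeration[OF perm(1), of 1]
  have jo: "j \<in> orbit \<alpha> 1" using p by (auto simp: j_def orbit_altdef)
  then show j: "j \<in> {1..n}" using orbit_1_subset by auto
  have jp: "j = (\<sigma> ^^ p) (n + 1)" unfolding j_def using p by (rule funpow_insert[symmetric])
  define \<beta> where "\<beta> = extend n \<alpha> j"
  have \<beta>: "\<beta> = Transposition.transpose (n + 1) j \<circ> \<sigma>"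
    unfolding \<beta>_def using j by (intro extend_pos) auto
  have "card (orbit \<beta> ` {1..n + 1}) = Suc (card (orbit \<sigma> ` {1..n + 1}))"
    unfolding \<beta>
  proof (rule card_orbits_transpose_split[OF perm(3)])
    show "j \<in> orbit \<sigma> (n + 1)" unfolding orbit_insert using jo by simp
  qed (use j in auto)
  then show "dP (FS (n + 1) (extend n \<alpha> j)) = Suc (dP (FS n \<alpha>))"
    unfolding card_cycles_insert by (simp add: dP_def FS_def cycle_supports_def \<beta>_def)
  have o: "orbit \<beta> j = (\<lambda>i. (\<sigma> ^^ i) (n + 1)) ` {p..<Suc ?c}"
    unfolding \<beta> using orbit_transpose_split(2)[OF perm(2) _ _ jp] p card_orbit_insert by simp
  have "(\<sigma> ^^ ?c) (n + 1) = 1" using funpow_insert[of ?c] e(3,4) by simp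
  then have "1 \<in> orbit \<beta> j" unfolding o using p(2) by (intro image_eqI[of _ _ ?c]) auto
  moreover have "permutation \<beta>"
    using extend_eq(2)[OF n \<alpha>, of j] j by (auto simp: permutation_permutes \<beta>_def)
  ultimately have "orbit \<beta> 1 = orbit \<beta> j" using orbit_eq_of_mem by metis
  moreover have "inj_on (\<lambda>i. (\<sigma> ^^ i) (n + 1)) {p..<Suc ?c}"
    using orbit_enumeration(2)[OF perm(2), of "n + 1"] unfolding card_orbit_insert
    by (rule inj_on_subset) auto
  ultimately show "card (orbit (extend n \<alpha> j) 1) = ?c + 1 - p"
    unfolding \<beta>_def[symmetric] o by (simp add: card_image)
qed

text \<open>
  Here \<open>j\<close> and \<open>n + 1\<close> lie in different cycles of \<open>\<sigma>\<close>, which the transposition merges.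
\<close>

lemma extend_outside_cycle:
  assumes "j \<in> {1..n}" "j \<notin> orbit \<alpha> 1"
  shows "Suc (dP (FS (n + 1) (extend n \<alpha> j))) = dP (FS n \<alpha>)"
proof -
  have \<beta>: "extend n \<alpha> j = Transposition.transpose (n + 1) j \<circ> \<sigma>"
    using assms by (intro extend_pos) auto
  have "Suc (card (orbit (extend n \<alpha> j) ` {1..n + 1})) = card (orbit \<sigma> ` {1..n + 1})"
    unfolding \<beta>
  proof (rule card_orbits_transpose_merge[OF perm(3)])
    show "j \<notin> orbit \<sigma> (n + 1)" unfolding orbit_insert using assms by simp
  qed (use assms in auto)
  then show ?thesis
    unfolding card_cycles_insert by (simp add: dP_def FS_def cycle_supports_def)
qed

lemma in_cycle_1_iff: "j \<in> orbit \<alpha> 1 \<longleftrightarrow> (\<exists>p. 1 \<le> p \<and> p \<le> card (orbit \<alpha> 1) \<and> j = (\<alpha> ^^ p) 1)"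
  using orbit_enumeration_from_1[OF perm(1), of 1] by (auto simp: set_eq_iff image_iff)

text \<open>
  Without merging, either a block is added and the cycles stay the same in number, or a cycle is
  added and the blocks stay the same in number; a merging removes a cycle and adds no block.
\<close>

lemma deg_extend:
  assumes "j \<le> n"
  shows "j = 0 \<or> j \<in> orbit \<alpha> 1 \<Longrightarrow> deg (FS (n + 1) (extend n \<alpha> j)) = Suc (deg (FS n \<alpha>))"
    and "\<not> (j = 0 \<or> j \<in> orbit \<alpha> 1) \<Longrightarrow> Suc (deg (FS (n + 1) (extend n \<alpha> j))) = deg (FS n \<alpha>)"
proof -
  assume "j = 0 \<or> j \<in> orbit \<alpha> 1"
  then show "deg (FS (n + 1) (extend n \<alpha> j)) = Suc (deg (FS n \<alpha>))"
  proof
    assume "j = 0"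
    then show ?thesis using extend_0(1) dD_extend[OF n \<alpha>, of 0] by (simp add: deg_def)
  next
    assume j: "j \<in> orbit \<alpha> 1"
    then have "j \<noteq> 0" using orbit_1_subset by auto
    obtain p where "1 \<le> p" "p \<le> card (orbit \<alpha> 1)" "j = (\<alpha> ^^ p) 1"
      using j unfolding in_cycle_1_iff by blast
    then show ?thesis
      using extend_in_cycle(2)[of p] dD_extend[OF n \<alpha> assms] \<open>j \<noteq> 0\<close> by (simp add: deg_def)
  qed
next
  assume j: "\<not> (j = 0 \<or> j \<in> orbit \<alpha> 1)"
  then have "Suc (dP (FS (n + 1) (extend n \<alpha> j))) = dP (FS n \<alpha>)"
    using assms by (intro extend_outside_cycle) auto
  then show "Suc (deg (FS (n + 1) (extend n \<alpha> j))) = deg (FS n \<alpha>)"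
    using dD_extend[OF n \<alpha> assms] j by (simp add: deg_def)
qed

end

section \<open>Counting ordinary summations\<close>

lemma dP_bounds:
  assumes "1 \<le> n"
  shows "1 \<le> dP (FS n \<alpha>)" and "dP (FS n \<alpha>) \<le> n"
proof -
  have "orbit \<alpha> 1 \<in> cycle_supports n \<alpha>" using assms by (auto simp: cycle_supports_def)
  then have "0 < card (cycle_supports n \<alpha>)" by (auto simp: card_gt_0_iff cycle_supports_def)
  then show "1 \<le> dP (FS n \<alpha>)" by (simp add: dP_def FS_def)
  show "dP (FS n \<alpha>) \<le> n"
    using card_image_le[of "{1..n}" "orbit \<alpha>"] by (simp add: dP_def FS_def cycle_supports_def)
qed

lemma deg_FS_1:
  assumes "\<alpha> permutes {1..1}"
  shows "\<alpha> = id" and "dP (FS 1 \<alpha>) = 1" and "deg (FS 1 \<alpha>) = 2" and "card (orbit \<alpha> 1) = 1"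
proof -
  show id: "\<alpha> = id" using assms by simp
  have "orbit id (1::nat) = {1}" by (simp add: orbit_eq_singleton_iff)
  then show "dP (FS 1 \<alpha>) = 1" "deg (FS 1 \<alpha>) = 2" "card (orbit \<alpha> 1) = 1"
    by (simp_all add: id deg_def dP_def dD_def FS_def cycle_supports_def)
qed

text \<open>
  This bound makes ordinary summations hereditary: once a step has lowered the degree, the value
  \<open>n + 1\<close> is out of reach for ever.
\<close>

lemma deg_le:
  assumes "1 \<le> n" "\<alpha> permutes {1..n}"
  shows "deg (FS n \<alpha>) \<le> n + 1"
  using assms
proof (induction n arbitrary: \<alpha> rule: nat_induct_at_least)
  case base
  show ?case unfolding deg_FS_1(3)[OF base] by simp
next
  case (Suc n)
  have "\<alpha> permutes {1..n + 1}" using Suc.prems by simp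
  then obtain \<alpha>' j where \<alpha>': "\<alpha>' permutes {1..n}" "j \<le> n" "\<alpha> = extend n \<alpha>' j"
    by (rule extend_surj[OF Suc.hyps])
  then show ?case
    using deg_extend[OF Suc.hyps \<alpha>'(1,2)] Suc.IH[OF \<alpha>'(1)]
    by (cases "j = 0 \<or> j \<in> orbit \<alpha>' 1") auto
qed

text \<open>
  The number of extensions of \<open>\<alpha>\<close> that stay ordinary depends on the length \<open>c\<close> of the cycle of \<open>1\<close>, so
  this statistic is needed to obtain a recursion.
\<close>

definition ordinary :: "nat \<Rightarrow> nat \<Rightarrow> nat \<Rightarrow> (nat \<Rightarrow> nat) set" where
  "ordinary n c r = {\<alpha>. \<alpha> permutes {1..n} \<and> deg (FS n \<alpha>) = n + 1 \<and> dP (FS n \<alpha>) = r \<and>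
    card (orbit \<alpha> 1) = c}"

lemma finite_ordinary: "finite (ordinary n c r)"
  by (rule finite_subset[OF _ finite_permutations[of "{1..n}"]]) (auto simp: ordinary_def)

lemma card_orbit_1_bounds:
  assumes "1 \<le> n" "\<alpha> permutes {1..n}"
  shows "1 \<le> card (orbit \<alpha> 1)" and "card (orbit \<alpha> 1) \<le> n"
proof -
  have "permutation \<alpha>" using assms(2) by (auto simp: permutation_permutes)
  then show "1 \<le> card (orbit \<alpha> 1)" using orbit_enumeration(4)[of \<alpha> 1] by simp
  show "card (orbit \<alpha> 1) \<le> n"
    using card_mono[OF _ orbit_1_subset[OF assms]] by simp
qed

text \<open>
  An ordinary \<open>\<beta> = [\<alpha>, j]\<close> comes from an ordinary \<open>\<alpha>\<close>.  If \<open>j = 0\<close>, the cycle of \<open>1\<close> was shorter by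
  one.  Otherwise \<open>j\<close> lies in the cycle of \<open>1\<close>, of length \<open>d\<close> say; as its position \<open>p\<close> runs through
  \<open>1, \<dots>, d\<close>, the new length \<open>d + 1 - p\<close> takes each of the values \<open>1, \<dots>, d\<close> once.  So every \<open>\<alpha>\<close> with
  \<open>d \<ge> c\<close> contributes one \<open>\<beta>\<close> with new length \<open>c\<close>, from position \<open>p = d + 1 - c\<close>.

  This is also the recursion for Dyck paths by the numbers of up-steps and peaks and the length of
  the final descent: before the last up-step there is either another up-step or a nonempty initial piece of
  the final descent of the path with \<open>n\<close> up-steps.
\<close>

lemma card_ordinary_Suc:
  assumes n: "1 \<le> n" and c: "1 \<le> c"
  shows "card (ordinary (n + 1) c (Suc r)) =
    card (ordinary n (c - 1) (Suc r)) + (\<Sum>d=c..n. card (ordinary n d r))"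
proof -
  let ?A = "ordinary n (c - 1) (Suc r)" and ?B = "\<Union>d\<in>{c..n}. ordinary n d r"
  let ?f = "\<lambda>\<alpha>. extend n \<alpha> 0"
  let ?j = "\<lambda>\<alpha>. (\<alpha> ^^ (card (orbit \<alpha> 1) + 1 - c)) 1"
  let ?g = "\<lambda>\<alpha>. extend n \<alpha> (?j \<alpha>)"
  have A: "\<alpha> permutes {1..n}" if "\<alpha> \<in> ?A" for \<alpha> using that by (simp add: ordinary_def)
  have B: "\<alpha> permutes {1..n}" "c \<le> card (orbit \<alpha> 1)" if "\<alpha> \<in> ?B" for \<alpha>
    using that by (auto simp: ordinary_def)
  have j: "?j \<alpha> \<in> {1..n}" "?j \<alpha> \<in> orbit \<alpha> 1" if "\<alpha> \<in> ?B" for \<alpha>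
  proof -
    have p: "1 \<le> card (orbit \<alpha> 1) + 1 - c" "card (orbit \<alpha> 1) + 1 - c \<le> card (orbit \<alpha> 1)"
      using B(2)[OF that] c by auto
    then show "?j \<alpha> \<in> {1..n}" by (rule extend_in_cycle(1)[OF n B(1)[OF that]])
    show "?j \<alpha> \<in> orbit \<alpha> 1" unfolding in_cycle_1_iff[OF n B(1)[OF that]] using p by blast
  qed
  have eq: "ordinary (n + 1) c (Suc r) = ?f ` ?A \<union> ?g ` ?B"
  proof (intro subset_antisym subsetI)
    fix \<beta> assume \<beta>: "\<beta> \<in> ordinary (n + 1) c (Suc r)"
    then have "\<beta> permutes {1..n + 1}" by (simp add: ordinary_def)
    then obtain \<alpha> i where \<alpha>: "\<alpha> permutes {1..n}" "i \<le> n" "\<beta> = extend n \<alpha> i"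
      by (rule extend_surj[OF n])
    have dle: "deg (FS n \<alpha>) \<le> n + 1" using n \<alpha>(1) by (rule deg_le)
    have \<beta>d: "deg (FS (n + 1) (extend n \<alpha> i)) = n + 2"
      "dP (FS (n + 1) (extend n \<alpha> i)) = Suc r" "card (orbit (extend n \<alpha> i) 1) = c"
      using \<beta> \<alpha>(3) by (simp_all add: ordinary_def)
    then have i: "i = 0 \<or> i \<in> orbit \<alpha> 1" 
      using deg_extend(2)[OF n \<alpha>(1,2)] dle by (intro ccontr[of "i = 0 \<or> i \<in> orbit \<alpha> 1"]) simp
    then have d: "deg (FS n \<alpha>) = n + 1" using deg_extend(1)[OF n \<alpha>(1,2)] \<beta>d(1) by simp
    from i show "\<beta> \<in> ?f ` ?A \<union> ?g ` ?B"
    proof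
      assume "i = 0"
      then have "\<alpha> \<in> ?A" using d \<alpha>(1) \<beta>d extend_0[OF n \<alpha>(1)] by (auto simp: ordinary_def)
      then show ?thesis using \<open>i = 0\<close> \<alpha>(3) by blast
    next
      assume "i \<in> orbit \<alpha> 1"
      then obtain p where p: "1 \<le> p" "p \<le> card (orbit \<alpha> 1)" "i = (\<alpha> ^^ p) 1"
        unfolding in_cycle_1_iff[OF n \<alpha>(1)] by blast
      note e = extend_in_cycle[OF n \<alpha>(1) p(1,2), folded p(3)]
      have pc: "card (orbit \<alpha> 1) + 1 - p = c" using e(3) \<beta>d(3) by simp
      then have "p = card (orbit \<alpha> 1) + 1 - c" using p by simp
      moreover have "\<alpha> \<in> ordinary n (card (orbit \<alpha> 1)) r"
        using d e(2) \<beta>d(2) \<alpha>(1) by (simp add: ordinary_def)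
      then have "\<alpha> \<in> ?B" using pc p(1) card_orbit_1_bounds(2)[OF n \<alpha>(1)] by auto
      ultimately show ?thesis using \<alpha>(3) p(3) by blast
    qed
  next
    fix \<beta> assume "\<beta> \<in> ?f ` ?A \<union> ?g ` ?B"
    then show "\<beta> \<in> ordinary (n + 1) c (Suc r)"
    proof
      assume "\<beta> \<in> ?f ` ?A"
      then obtain \<alpha> where \<alpha>: "\<alpha> \<in> ?A" "\<beta> = extend n \<alpha> 0" by blast
      then show ?thesis
        using extend_0[OF n A[OF \<alpha>(1)]] deg_extend(1)[OF n A[OF \<alpha>(1)], of 0]
          extend_eq(2)[OF n A[OF \<alpha>(1)], of 0] c
        by (simp add: ordinary_def)
    next
      assume "\<beta> \<in> ?g ` ?B"
      then obtain \<alpha> where \<alpha>: "\<alpha> \<in> ?B" "\<beta> = ?g \<alpha>" by blast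
      let ?p = "card (orbit \<alpha> 1) + 1 - c"
      have p: "1 \<le> ?p" "?p \<le> card (orbit \<alpha> 1)" using B(2)[OF \<alpha>(1)] c by auto
      have jn: "?j \<alpha> \<le> n" using j(1)[OF \<alpha>(1)] by simp
      have \<alpha>': "deg (FS n \<alpha>) = n + 1" "dP (FS n \<alpha>) = r" using \<alpha>(1) by (auto simp: ordinary_def)
      have "card (orbit \<beta> 1) = card (orbit \<alpha> 1) + 1 - ?p"
        unfolding \<alpha>(2) by (rule extend_in_cycle(3)[OF n B(1)[OF \<alpha>(1)] p])
      also have "\<dots> = c" using B(2)[OF \<alpha>(1)] by simp
      finally have "card (orbit \<beta> 1) = c" .
      moreover have "dP (FS (n + 1) \<beta>) = Suc r"
        unfolding \<alpha>(2) using extend_in_cycle(2)[OF n B(1)[OF \<alpha>(1)] p] \<alpha>'(2) by simp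
      moreover have "deg (FS (n + 1) \<beta>) = n + 2"
        unfolding \<alpha>(2) using deg_extend(1)[OF n B(1)[OF \<alpha>(1)] jn] j(2)[OF \<alpha>(1)] \<alpha>'(1) by simp
      moreover have "\<beta> permutes {1..n + 1}"
        unfolding \<alpha>(2) using extend_eq(2)[OF n B(1)[OF \<alpha>(1)] jn] .
      ultimately show ?thesis by (simp add: ordinary_def)
    qed
  qed
  have "inj_on ?f ?A" using extend_inject[OF n A A] by (auto intro!: inj_onI)
  moreover have "inj_on ?g ?B"
  proof (rule inj_onI)
    fix \<alpha> \<alpha>' assume "\<alpha> \<in> ?B" "\<alpha>' \<in> ?B" "?g \<alpha> = ?g \<alpha>'"
    then show "\<alpha> = \<alpha>'"
      using extend_inject[OF n B(1)[of \<alpha>] B(1)[of \<alpha>'], of "?j \<alpha>" "?j \<alpha>'"] j(1)[of \<alpha>] j(1)[of \<alpha>'] by auto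
  qed
  moreover have "?f ` ?A \<inter> ?g ` ?B = {}"
  proof -
    have "?f \<alpha> \<noteq> ?g \<alpha>'" if "\<alpha> \<in> ?A" "\<alpha>' \<in> ?B" for \<alpha> \<alpha>'
      using extend_inject[OF n A[OF that(1)] B(1)[OF that(2)], of 0 "?j \<alpha>'"] j(1)[OF that(2)] by auto
    then show ?thesis by blast
  qed
  moreover have "card ?B = (\<Sum>d=c..n. card (ordinary n d r))"
    by (rule card_UN_disjoint) (auto simp: finite_ordinary, auto simp: ordinary_def)
  ultimately show ?thesis
    unfolding eq by (subst card_Un_disjoint) (auto simp: card_image finite_ordinary)
qed

text \<open>
  The closed form of the solution, with \<open>s = r - 1\<close>: the number of Dyck paths with \<open>n\<close> up-steps,
  \<open>s + 1\<close> peaks and a final descent of length \<open>c\<close>.  A single peak forces \<open>c = n\<close>, which the product of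
  binomial coefficients does not express.
\<close>

definition ordinary_count :: "nat \<Rightarrow> nat \<Rightarrow> nat \<Rightarrow> real" where
  "ordinary_count n c s =
    (if s = 0 then of_bool (c = n)
     else if c < n then real c / real n * real (n choose s) * real ((n - c - 1) choose (s - 1))
     else 0)"

text \<open>
  The terms are added from \<open>d = n\<close> downwards; for \<open>s \<ge> 1\<close> each addition is Pascal's rule applied to
  both \<open>C(n - c, s)\<close> and \<open>C(n - c, s + 1)\<close>.  The case \<open>c = 1\<close> yields the Narayana
  number; the general case evaluates the sum in the recursion.
\<close>

lemma sum_ordinary_count:
  assumes "1 \<le> n" "c \<le> n"
  shows "(\<Sum>d=c..n. ordinary_count n d s) =
    real (n choose s) / real n * (real c * real ((n - c) choose s) + real ((n - c) choose (Suc s)))"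
  using assms(2)
proof (induction c rule: inc_induct)
  case base
  then show ?case using assms(1) by (cases s) (simp_all add: ordinary_count_def)
next
  case (step c)
  define m where "m = n - Suc c"
  have m: "n - c = Suc m" "n - Suc c = m" "n = Suc (c + m)" using step.hyps by (auto simp: m_def)
  have "(\<Sum>d=c..n. ordinary_count n d s) =
      ordinary_count n c s + (\<Sum>d=Suc c..n. ordinary_count n d s)"
    using step.hyps by (intro sum.atLeast_Suc_atMost) auto
  also have "\<dots> = real (n choose s) / real n *
      (real c * real ((n - c) choose s) + real ((n - c) choose (Suc s)))"
  proof (cases s)
    case 0
    then show ?thesis using step.hyps unfolding step.IH m(1,2) by (simp add: ordinary_count_def)
  next
    case (Suc t)
    have "ordinary_count n c s = real (n choose s) / real n * (real c * real (m choose t))"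
      using step.hyps Suc m by (simp add: ordinary_count_def)
    then show ?thesis unfolding step.IH m(1,2) by (simp add: Suc algebra_simps)
  qed
  finally show ?case .
qed

lemma real_binomial_Suc: "real (n choose Suc s) = (real n - real s) * real (n choose s) / (real s + 1)"
proof -
  have "Suc s * (n choose Suc s) = (n - s) * (n choose s)"
    by (simp only: binomial_absorption binomial_absorb_comp)
  then have "real (Suc s) * real (n choose Suc s) = real (n - s) * real (n choose s)"
    by (metis of_nat_mult)
  also have "\<dots> = (real n - real s) * real (n choose s)"
    by (cases "s \<le> n") (simp_all add: of_nat_diff binomial_eq_0)
  finally show ?thesis by (simp add: field_simps)
qed

text \<open>
  All binomial coefficients involved are rational multiples of \<open>a = C(n, s)\<close> and \<open>b = C(n - c, s)\<close>,
  so that only an identity between the rational factors remains.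
\<close>

lemma ordinary_count_Suc:
  assumes "1 \<le> n" "1 \<le> c" "c \<le> n"
  shows "ordinary_count (n + 1) c (Suc s) =
    ordinary_count n (c - 1) (Suc s) + (\<Sum>d=c..n. ordinary_count n d s)"
proof -
  define a b where "a = real (n choose s)" and "b = real ((n - c) choose s)"
  have A: "real (n choose Suc s) = (real n - real s) * a / (real s + 1)"
    and B: "real ((n - c) choose Suc s) = (real n - real c - real s) * b / (real s + 1)"
    using assms by (simp_all only: real_binomial_Suc a_def b_def of_nat_diff)
  have C: "real (Suc n choose Suc s) = (real n + 1) * a / (real s + 1)"
    using Suc_times_binomial[of s n] unfolding a_def
    by (simp add: field_simps flip: of_nat_mult of_nat_Suc)
  have "ordinary_count (n + 1) c (Suc s) = real c / (real n + 1) * ((real n + 1) * a / (real s + 1)) * b"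
    using assms unfolding C[symmetric] by (simp add: ordinary_count_def b_def)
  moreover have "ordinary_count n (c - 1) (Suc s) =
      (real c - 1) / real n * ((real n - real s) * a / (real s + 1)) * b"
    using assms unfolding A[symmetric] by (auto simp: ordinary_count_def b_def of_nat_diff)
  moreover have "(\<Sum>d=c..n. ordinary_count n d s) =
      a / real n * (real c * b + (real n - real c - real s) * b / (real s + 1))"
    using sum_ordinary_count[OF assms(1,3), of s] unfolding a_def[symmetric] b_def[symmetric] B .
  moreover have "real c / (real n + 1) * ((real n + 1) * a / (real s + 1)) * b =
      (real c - 1) / real n * ((real n - real s) * a / (real s + 1)) * b +
      a / real n * (real c * b + (real n - real c - real s) * b / (real s + 1))"
  proof -
    have "real n > 0" "real n + 1 > 0" "real s + 1 > 0" using assms by auto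
    then show ?thesis by (simp add: divide_simps) (simp add: algebra_simps)
  qed
  ultimately show ?thesis by simp
qed

lemma card_ordinary:
  assumes "1 \<le> n"
  shows "real (card (ordinary n c (Suc s))) = ordinary_count n c s"
  using assms
proof (induction n arbitrary: c s rule: nat_induct_at_least)
  case base
  have "ordinary 1 c (Suc s) = (if c = 1 \<and> s = 0 then {id} else {})"
    using deg_FS_1 by (auto simp: ordinary_def)
  then show ?case by (auto simp: ordinary_count_def)
next
  case (Suc n)
  have "dP (FS n \<alpha>) \<noteq> 0" for \<alpha> using dP_bounds(1)[OF Suc.hyps, of \<alpha>] by simp
  then have "ordinary n d 0 = {}" for d unfolding ordinary_def by blast
  then have IH: "real (card (ordinary n d r)) = (if r = 0 then 0 else ordinary_count n d (r - 1))" for d r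
    using Suc.IH[of d "r - 1"] by (cases r) auto
  show ?case
  proof (cases "c = 0")
    case True
    have "ordinary (Suc n) 0 (Suc s) = {}"
      using card_orbit_1_bounds(1)[of "Suc n"] by (fastforce simp: ordinary_def)
    then show ?thesis using True by (simp add: ordinary_count_def)
  next
    case False
    then have "card (ordinary (Suc n) c (Suc s)) =
        card (ordinary n (c - 1) (Suc s)) + (\<Sum>d=c..n. card (ordinary n d s))"
      using card_ordinary_Suc[OF Suc.hyps, of c s] by simp
    then have rec: "real (card (ordinary (Suc n) c (Suc s))) =
        ordinary_count n (c - 1) s + (\<Sum>d=c..n. if s = 0 then 0 else ordinary_count n d (s - 1))"
      by (simp add: IH)
    show ?thesis
    proof (cases s)
      case 0
      then show ?thesis unfolding rec using False by (auto simp: ordinary_count_def)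
    next
      case (Suc t)
      show ?thesis
      proof (cases "c \<le> n")
        case True
        then show ?thesis
          unfolding rec using ordinary_count_Suc[OF Suc.hyps _ True, of t] False \<open>s = Suc t\<close> by simp
      next
        case False
        then show ?thesis unfolding rec using \<open>s = Suc t\<close> by (simp add: ordinary_count_def)
      qed
    qed
  qed
qed

lemma card_ordinary_type:
  assumes "1 \<le> n" "1 \<le> r"
  shows "real (card {\<alpha>. \<alpha> permutes {1..n} \<and> deg (FS n \<alpha>) = n + 1 \<and> dP (FS n \<alpha>) = r}) =
    1 / (real n + 1) * real ((n + 1) choose r) * real ((n - 1) choose (r - 1))"
proof -
  obtain s where r: "r = Suc s" using assms(2) by (cases r) auto
  obtain m where n: "n = Suc m" using assms(1) by (cases n) auto
  have "{\<alpha>. \<alpha> permutes {1..n} \<and> deg (FS n \<alpha>) = n + 1 \<and> dP (FS n \<alpha>) = r} =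
      (\<Union>c\<in>{1..n}. ordinary n c r)"
    using card_orbit_1_bounds[OF assms(1)] by (auto simp: ordinary_def)
  moreover have "card (\<Union>c\<in>{1..n}. ordinary n c r) = (\<Sum>c=1..n. card (ordinary n c r))"
    by (rule card_UN_disjoint) (auto simp: finite_ordinary, auto simp: ordinary_def)
  ultimately have "real (card {\<alpha>. \<alpha> permutes {1..n} \<and> deg (FS n \<alpha>) = n + 1 \<and> dP (FS n \<alpha>) = r}) =
      (\<Sum>c=1..n. ordinary_count n c s)"
    by (simp add: r card_ordinary[OF assms(1)])
  also have "\<dots> = real (n choose s) / real n * real (n choose Suc s)"
    using sum_ordinary_count[OF assms(1) assms(1), of s] by (simp add: n)
  also have "\<dots> = 1 / (real n + 1) * real ((n + 1) choose r) * real ((n - 1) choose (r - 1))"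
  proof -
    have "real (n + 1 choose r) = (real n + 1) * real (n choose s) / (real s + 1)"
      using Suc_times_binomial[of s n] by (simp add: r field_simps flip: of_nat_mult of_nat_Suc)
    moreover have "real (n choose Suc s) = real n * real ((n - 1) choose s) / (real s + 1)"
      using Suc_times_binomial[of s m] by (simp add: n field_simps flip: of_nat_mult of_nat_Suc)
    moreover have "real n > 0" "real n + 1 > 0" "real s + 1 > 0" using assms by auto
    ultimately show ?thesis by (simp add: r)
  qed
  finally show ?thesis .
qed

text \<open>
  After reflecting the second factor, \<open>C(n - 1, r - 1) = C(n - 1, n - r)\<close>, this is Vandermonde's
  convolution; its term for \<open>r = 0\<close> vanishes because \<open>C(n - 1, n) = 0\<close>.
\<close>

lemma sum_narayana:
  assumes "1 \<le> n"
  shows "(\<Sum>r=1..n. ((n + 1) choose r) * ((n - 1) choose (r - 1))) = (2 * n) choose n"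
proof -
  have "(\<Sum>r=1..n. ((n + 1) choose r) * ((n - 1) choose (r - 1))) =
      (\<Sum>r=1..n. ((n + 1) choose r) * ((n - 1) choose (n - r)))"
  proof (rule sum.cong[OF refl])
    fix r assume "r \<in> {1..n}"
    then have "n - 1 - (r - 1) = n - r" "r - 1 \<le> n - 1" by auto
    then show "((n + 1) choose r) * ((n - 1) choose (r - 1)) = ((n + 1) choose r) * ((n - 1) choose (n - r))"
      using binomial_symmetric[of "r - 1" "n - 1"] by simp
  qed
  also have "\<dots> = (\<Sum>r\<in>insert 0 {1..n}. ((n + 1) choose r) * ((n - 1) choose (n - r)))"
    using assms by simp
  also have "insert 0 {1..n} = {..n}" by auto
  also have "(\<Sum>r\<le>n. ((n + 1) choose r) * ((n - 1) choose (n - r))) = (n + 1 + (n - 1)) choose n"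
    by (rule vandermonde)
  also have "n + 1 + (n - 1) = 2 * n" using assms by simp
  finally show ?thesis .
qed

theorem corollary5p5:
  fixes n :: nat
  assumes "n \<ge> 1"
  shows "(\<forall>r. 1 \<le> r \<and> r \<le> n \<longrightarrow>
      real (card {\<alpha>. \<alpha> permutes {1..n} \<and> dP (FS n \<alpha>) = r \<and> dD (FS n \<alpha>) = n - r + 1}) =
        1 / (real n + 1) * real ((n + 1) choose r) * real ((n - 1) choose (r - 1))) \<and>
    real (card {\<alpha>. \<alpha> permutes {1..n} \<and> deg (FS n \<alpha>) = n + 1}) =
      (\<Sum>r=1..n. 1 / (real n + 1) * real ((n + 1) choose r) * real ((n - 1) choose (r - 1))) \<and>
    (\<Sum>r=1..n. 1 / (real n + 1) * real ((n + 1) choose r) * real ((n - 1) choose (r - 1))) =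
      1 / (real n + 1) * real ((2 * n) choose n)"
proof (intro conjI allI impI)
  let ?T = "\<lambda>r. {\<alpha>. \<alpha> permutes {1..n} \<and> deg (FS n \<alpha>) = n + 1 \<and> dP (FS n \<alpha>) = r}"
  fix r assume r: "1 \<le> r \<and> r \<le> n"
  then have "{\<alpha>. \<alpha> permutes {1..n} \<and> dP (FS n \<alpha>) = r \<and> dD (FS n \<alpha>) = n - r + 1} = ?T r"
    by (auto simp: deg_def)
  then show "real (card {\<alpha>. \<alpha> permutes {1..n} \<and> dP (FS n \<alpha>) = r \<and> dD (FS n \<alpha>) = n - r + 1}) =
      1 / (real n + 1) * real ((n + 1) choose r) * real ((n - 1) choose (r - 1))"
    using card_ordinary_type[OF assms, of r] r by simp
next
  let ?T = "\<lambda>r. {\<alpha>. \<alpha> permutes {1..n} \<and> deg (FS n \<alpha>) = n + 1 \<and> dP (FS n \<alpha>) = r}"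
  have "{\<alpha>. \<alpha> permutes {1..n} \<and> deg (FS n \<alpha>) = n + 1} = (\<Union>r\<in>{1..n}. ?T r)"
    using dP_bounds[OF assms] by auto
  moreover have "card (\<Union>r\<in>{1..n}. ?T r) = (\<Sum>r=1..n. card (?T r))"
    by (rule card_UN_disjoint)
      (auto intro: finite_subset[OF _ finite_permutations[of "{1..n}"]])
  ultimately have "real (card {\<alpha>. \<alpha> permutes {1..n} \<and> deg (FS n \<alpha>) = n + 1}) =
      (\<Sum>r=1..n. real (card (?T r)))"
    by simp
  also have "\<dots> =
      (\<Sum>r=1..n. 1 / (real n + 1) * real ((n + 1) choose r) * real ((n - 1) choose (r - 1)))"
    using card_ordinary_type[OF assms] by (intro sum.cong) simp_all
  finally show "real (card {\<alpha>. \<alpha> permutes {1..n} \<and> deg (FS n \<alpha>) = n + 1}) =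
      (\<Sum>r=1..n. 1 / (real n + 1) * real ((n + 1) choose r) * real ((n - 1) choose (r - 1)))" .
next
  have "(\<Sum>r=1..n. 1 / (real n + 1) * real ((n + 1) choose r) * real ((n - 1) choose (r - 1))) =
      1 / (real n + 1) * real (\<Sum>r=1..n. ((n + 1) choose r) * ((n - 1) choose (r - 1)))"
    unfolding of_nat_sum of_nat_mult sum_distrib_left mult.assoc ..
  then show "(\<Sum>r=1..n. 1 / (real n + 1) * real ((n + 1) choose r) * real ((n - 1) choose (r - 1))) =
      1 / (real n + 1) * real ((2 * n) choose n)"
    unfolding sum_narayana[OF assms] .
qed

end
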